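(* Let $(\Omega,\mathcal{E})$ be a measurable space, let $S$ be a Souslin space, and let $X$ be a Hausdorff space with second countable compacts. Let $\{F_s\}_{s\in S}$ be a compact-measurable family of closed-valued multifunctions $F_s:\Omega\to X$. Then the multifunction $\omega\mapsto \bigcap_{s\in S}F_s(\omega)$ from $\Omega$ to $X$ is universally compact-measurable.
   Context: A multifunction $F:\Omega\to X$ is a function assigning to each $\omega\in\Omega$ a (possibly empty) subset $F(\omega)\subset X$; it is closed-valued if every $F(\omega)$ is closed. For $A\subset X$ put $F^{-1}(A)=\{\omega : F(\omega)\cap A\neq\emptyset\}$. $F$ is compact-measurable (with respect to a $\sigma$-algebra on its domain) if $F^{-1}(K)$ is measurable for every compact $K\subset X$, and universally compact-measurable if $F^{-1}(K)$ is universally measurable for every compact $K\subset X$. Universally measurable sets: for a finite positive measure $\nu$ on $(\Omega,\mathcal{E})$, $\mathcal{E}_\nu$ is the family of sets $B\subset\Omega$ for which there are $A,C\in\mathcal{E}$ with $A\subset B\subset C$ and $\nu(C\setminus A)=0$. A set is universally measurable if it belongs to $\hat{\mathcal{E}}=\bigcap_\nu \mathcal{E}_\nu$, the intersection being over all finite positive measures $\nu$ on $\mathcal{E}$. A Souslin space is a metric space which is the image of a Polish space under a continuous map; it carries its Borel $\sigma$-algebra $\mathcal{B}(S)$. The family $\{F_s\}_{s\in S}$ is compact-measurable if the multifunction $(\omega,s)\mapsto F_s(\omega)$ from $\Omega\times S$ to $X$ is compact-measurable with respect to the product $\sigma$-algebra $\mathcal{E}\otimes\mathcal{B}(S)$.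 A topological space $X$ has second countable compacts if every compact subset of $X$ is second countable in its relative topology. *)

theory Defs
  imports "HOL-Analysis.Analysis"
begin

text \<open>
  All spaces are given by carriers inside arbitrary types: a measurable space is a
  \<^typ>\<open>'a measure\<close> of which only \<^const>\<open>space\<close> and \<^const>\<open>sets\<close> are used, a topological
  space is an \<^typ>\<open>'a topology\<close>, a metric space is an \<^typ>\<open>'a metric\<close>.  Empty spaces are allowed.
  Multifunctions are set-valued functions whose values off the carrier are irrelevant.
\<close>

definition borel_of :: "'a topology \<Rightarrow> 'a measure" where
  "borel_of T = sigma (topspace T) {U. openin T U}"

definition null_sandwiched_sets :: "'a measure \<Rightarrow> 'a set set" where
  "null_sandwiched_sets \<nu> =
     {B. \<exists>A\<in>sets \<nu>. \<exists>C\<in>sets \<nu>. A \<subseteq> B \<and> B \<subseteq> C \<and> emeasure \<nu> (C - A) = 0}"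

definition universally_measurable_sets :: "'a measure \<Rightarrow> 'a set set" where
  "universally_measurable_sets M =
     {B. \<forall>\<nu>. finite_measure \<nu> \<and> sets \<nu> = sets M \<longrightarrow> B \<in> null_sandwiched_sets \<nu>}"

definition multi_preimage :: "'w set \<Rightarrow> ('w \<Rightarrow> 'x set) \<Rightarrow> 'x set \<Rightarrow> 'w set" where
  "multi_preimage \<Omega> F A = {\<omega>\<in>\<Omega>. F \<omega> \<inter> A \<noteq> {}}"

definition closed_valued :: "'w set \<Rightarrow> 'x topology \<Rightarrow> ('w \<Rightarrow> 'x set) \<Rightarrow> bool" where
  "closed_valued \<Omega> X F \<longleftrightarrow> (\<forall>\<omega>\<in>\<Omega>. closedin X (F \<omega>))"

definition compact_measurable :: "'w measure \<Rightarrow> 'x topology \<Rightarrow> ('w \<Rightarrow> 'x set) \<Rightarrow> bool" where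
  "compact_measurable M X F \<longleftrightarrow>
     (\<forall>K. compactin X K \<longrightarrow> multi_preimage (space M) F K \<in> sets M)"

definition universally_compact_measurable ::
    "'w measure \<Rightarrow> 'x topology \<Rightarrow> ('w \<Rightarrow> 'x set) \<Rightarrow> bool" where
  "universally_compact_measurable M X F \<longleftrightarrow>
     (\<forall>K. compactin X K \<longrightarrow> multi_preimage (space M) F K \<in> universally_measurable_sets M)"

definition compact_measurable_family ::
    "'w measure \<Rightarrow> 's metric \<Rightarrow> 'x topology \<Rightarrow> ('s \<Rightarrow> 'w \<Rightarrow> 'x set) \<Rightarrow> bool" where
  "compact_measurable_family M S X F \<longleftrightarrow>
     compact_measurable (M \<Otimes>\<^sub>M borel_of (mtopology_of S)) X (\<lambda>(\<omega>, s). F s \<omega>)"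

text \<open>As in the class \<^class>\<open>polish_space\<close>, separability is expressed by second countability.\<close>

definition Polish_topology :: "'p topology \<Rightarrow> bool" where
  "Polish_topology P \<longleftrightarrow> completely_metrizable_space P \<and> second_countable P"

text \<open>
  HOL cannot quantify over the type carrying the Polish space, so that type is a parameter.
  A theorem assuming \<open>souslin_space TYPE('p) S\<close> for a type variable \<open>'p\<close> therefore
  covers images of Polish spaces over every type.
\<close>

definition souslin_space :: "'p itself \<Rightarrow> 's metric \<Rightarrow> bool" where
  "souslin_space _ S \<longleftrightarrow>
     (\<exists>(P :: 'p topology) f. Polish_topology P \<and> continuous_map P (mtopology_of S) f \<and>
        f ` topspace P = mspace S)"

definition second_countable_compacts :: "'x topology \<Rightarrow> bool" where
  "second_countable_compacts X \<longleftrightarrow>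
     (\<forall>K. compactin X K \<longrightarrow> second_countable (subtopology X K))"

text \<open>Intersecting with the carrier makes the intersection of the empty family all of \<open>X\<close>.\<close>

definition family_Inter ::
    "'s set \<Rightarrow> 'x topology \<Rightarrow> ('s \<Rightarrow> 'w \<Rightarrow> 'x set) \<Rightarrow> 'w \<Rightarrow> 'x set" where
  "family_Inter I X F \<omega> = topspace X \<inter> (\<Inter>s\<in>I. F s \<omega>)"

end

theory Submission
  imports Defs
begin

text \<open>
  Fix a compact \<open>K\<close> with countable base \<open>\<B>\<close>. By compactness and regularity, \<open>\<Inter>\<^sub>s F\<^sub>s(\<omega>)\<close> misses \<open>K\<close>
  iff \<open>K\<close> has a finite cover by members of \<open>\<B>\<close> such that the closure of each of them misses some
  \<open>F\<^sub>s(\<omega>)\<close>. There are countably many such covers, so it remains to see that the projection to \<open>\<Omega>\<close> of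
  a measurable subset of \<open>\<Omega> \<times> S\<close> is universally measurable. As \<open>S\<close> is a continuous image of the Baire
  space \<open>\<nat> \<Rightarrow> \<nat>\<close>, we may replace \<open>S\<close> by the latter, where measurable sets and their projections are
  results of the Souslin operation. Such a set is approximated in measure from inside by
  restricting the branches to a compact box \<open>{z. \<forall>i. z i \<le> k i}\<close>, with \<open>k\<close> chosen one coordinate
  at a time by continuity from below of the outer measure.
\<close>

section \<open>Universal measurability through completions of measures\<close>

text \<open>Turns the sandwich condition into membership in a completion, so that the
  \<sigma>-algebra structure of the latter applies. The null set is \<open>C - A\<close> in one
  direction, and \<open>N'\<close> with the sandwich \<open>S\<close>, \<open>S \<union> N'\<close>
  in the other.\<close>

lemma null_sandwiched_sets_eq: "null_sandwiched_sets \<nu> = sets (completion \<nu>)"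
proof (intro set_eqI iffI)
  fix B assume "B \<in> null_sandwiched_sets \<nu>"
  then obtain A C where AC: "A \<in> sets \<nu>" "C \<in> sets \<nu>" "A \<subseteq> B" "B \<subseteq> C" "emeasure \<nu> (C - A) = 0"
    unfolding null_sandwiched_sets_def by blast
  show "B \<in> sets (completion \<nu>)"
    by (rule sets_completionI[of B A "B - A" "C - A"]) (use AC in \<open>auto simp: null_sets_def\<close>)
next
  fix B assume "B \<in> sets (completion \<nu>)"
  then obtain S N N' where SN: "B = S \<union> N" "N \<subseteq> N'" "N' \<in> null_sets \<nu>" "S \<in> sets \<nu>"
    by (rule sets_completionE)
  have N': "N' \<in> sets \<nu>" "emeasure \<nu> N' = 0" using SN(3) by auto
  have "emeasure \<nu> (S \<union> N' - S) \<le> emeasure \<nu> N'"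
    by (rule emeasure_mono) (use N' in auto)
  then have "emeasure \<nu> (S \<union> N' - S) = 0" using N' by simp
  then show "B \<in> null_sandwiched_sets \<nu>"
    unfolding null_sandwiched_sets_def using SN N'(1)
    by (intro CollectI bexI[of _ S] bexI[of _ "S \<union> N'"]) auto
qed

lemma universally_measurable_sets_iff:
  "B \<in> universally_measurable_sets M \<longleftrightarrow>
     (\<forall>\<nu>. finite_measure \<nu> \<longrightarrow> sets \<nu> = sets M \<longrightarrow> B \<in> sets (completion \<nu>))"
  by (auto simp: universally_measurable_sets_def null_sandwiched_sets_eq)

text \<open>A countable union \<open>L'\<close> of measurable subsets of \<open>B\<close> reaches
  the supremum of their measures, which by the inner approximation is the measure of a measurable
  hull \<open>E\<close>. Hence \<open>B\<close> lies between two measurable sets with null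
  difference.\<close>

lemma sets_completion_if_inner_approx:
  assumes "finite_measure \<nu>" and B: "B \<subseteq> space \<nu>"
    and inner: "\<And>r. r < outer_measure_of \<nu> B \<Longrightarrow> \<exists>L\<in>sets \<nu>. L \<subseteq> B \<and> r \<le> emeasure \<nu> L"
  shows "B \<in> sets (completion \<nu>)"
proof -
  interpret finite_measure \<nu> by fact
  obtain E where E: "E \<in> sets \<nu>" "B \<subseteq> E" "outer_measure_of \<nu> B = emeasure \<nu> E"
    using outer_measure_of_attain[OF B] by blast
  define \<L> where "\<L> = {L \<in> sets \<nu>. L \<subseteq> B}"
  have "{} \<in> \<L>" by (auto simp: \<L>_def)
  then have "emeasure \<nu> ` \<L> \<noteq> {}" by auto
  from ennreal_Sup_countable_SUP[OF this] obtain f :: "nat \<Rightarrow> ennreal"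
    where f: "range f \<subseteq> emeasure \<nu> ` \<L>" "Sup (emeasure \<nu> ` \<L>) = Sup (range f)"
    by metis
  then have "\<forall>n. \<exists>L. L \<in> \<L> \<and> f n = emeasure \<nu> L" by blast
  then obtain L where L: "\<And>n::nat. L n \<in> \<L>" "\<And>n. f n = emeasure \<nu> (L n)" by metis
  define L' where "L' = (\<Union>n. L n)"
  have L': "L' \<in> sets \<nu>" "L' \<subseteq> B" using L(1) by (auto simp: L'_def \<L>_def)
  have "emeasure \<nu> E \<le> emeasure \<nu> L'"
  proof (rule dense_le)
    fix r assume "r < emeasure \<nu> E"
    then obtain K where "K \<in> \<L>" "r \<le> emeasure \<nu> K" using inner E(3) by (auto simp: \<L>_def)
    then have "r \<le> Sup (emeasure \<nu> ` \<L>)" by (meson SUP_upper2)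
    also have "\<dots> \<le> emeasure \<nu> L'"
      unfolding f(2) using L L' by (auto intro!: SUP_least emeasure_mono simp: L'_def)
    finally show "r \<le> emeasure \<nu> L'" .
  qed
  \<comment> \<open>The measures may be subtracted because \<nu> is finite.\<close>
  moreover have "emeasure \<nu> (E - L') = emeasure \<nu> E - emeasure \<nu> L'"
    by (rule emeasure_Diff) (use L' E in auto)
  ultimately have "emeasure \<nu> (E - L') = 0" by (simp add: diff_eq_0_iff_ennreal less_top[symmetric])
  then have "E - L' \<in> null_sets \<nu>" using E L' by auto
  then show ?thesis
    by (rule sets_completionI[of B L' "B - L'" "E - L'", rotated 2]) (use L' E in auto)
qed

section \<open>Compactness in the Baire space and the Souslin operation\<close>

text \<open>Tychonoff: the box is a product of finite sets.\<close>

lemma compact_nat_box: "compact {z :: nat \<Rightarrow> nat. \<forall>i. z i \<le> k i}"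
proof -
  have "compactin (product_topology (\<lambda>_. euclidean) UNIV) (PiE UNIV (\<lambda>i. {..k i}))"
    by (subst compactin_PiE) (auto intro: finite_imp_compact)
  moreover have "PiE UNIV (\<lambda>i. {..k i}) = {z. \<forall>i. z i \<le> k i}" by auto
  ultimately show ?thesis by (simp add: euclidean_product_topology)
qed

text \<open>Coordinates are continuous with discrete values, so each one is eventually constant, and
  finitely many are so simultaneously.\<close>

lemma eventually_agree_below:
  fixes x :: "nat \<Rightarrow> nat \<Rightarrow> nat"
  assumes "x \<longlonglongrightarrow> y"
  shows "\<forall>\<^sub>F n in sequentially. \<forall>i<N. x n i = y i"
proof -
  have "\<forall>\<^sub>F n in sequentially. x n i = y i" for i
  proof -
    have "((\<lambda>n. x n i) \<longlongrightarrow> y i) sequentially"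
      by (rule tendsto_compose[OF _ assms, of "\<lambda>z. z i", unfolded o_def])
        (metis continuous_on_def continuous_on_product_coordinates UNIV_I)
    then show ?thesis by (simp add: tendsto_discrete)
  qed
  then have "\<forall>\<^sub>F n in sequentially. \<forall>i\<in>{..<N}. x n i = y i"
    by (intro eventually_ball_finite) auto
  then show ?thesis by (simp add: lessThan_def)
qed

text \<open>
  A Souslin scheme indexed by finite sequences is encoded as a sequence of finitely determined
  functions of the whole branch, the \<open>n\<close>-th of which may look at more than \<open>n\<close> coordinates.
\<close>

definition finitely_determined :: "((nat \<Rightarrow> nat) \<Rightarrow> 'b) \<Rightarrow> bool" where
  "finitely_determined A \<longleftrightarrow> (\<exists>N. \<forall>z z'. (\<forall>i<N. z i = z' i) \<longrightarrow> A z = A z')"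

text \<open>Bundles the functions up to index \<open>m\<close> into one, so that a single bound
  serves them all: the maximum of their bounds.\<close>

lemma finitely_determined_restrict:
  assumes "\<And>j. finitely_determined (A j)"
  shows "finitely_determined (\<lambda>z. \<lambda>j\<in>{..m::nat}. A j z)"
proof -
  obtain N where N: "\<And>j z z'. (\<forall>i<N j. z i = z' i) \<Longrightarrow> A j z = A j z'"
    using assms unfolding finitely_determined_def by metis
  have "(\<lambda>j\<in>{..m}. A j z) = (\<lambda>j\<in>{..m}. A j z')" if "\<forall>i<Max (N ` {..m}). z i = z' i" for z z'
  proof (intro restrict_ext N allI impI)
    fix j i assume "j \<in> {..m}" "i < N j"
    then have "i < Max (N ` {..m})" by (meson Max_ge finite_atMost finite_imageI imageI order_less_le_trans)
    with that show "z i = z' i" by blast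
  qed
  then show ?thesis unfolding finitely_determined_def by blast
qed

text \<open>For \<open>r\<close> below the outer measure, coordinates are bounded one at a time
  while the outer measure stays above \<open>r\<close>. The conditions up to \<open>m\<close> then
  give decreasing measurable sets \<open>D m\<close> of measure at least \<open>r\<close>, and
  compactness of the box puts their intersection inside the result.\<close>

lemma souslin_operation_sets_completion:
  fixes A :: "nat \<Rightarrow> (nat \<Rightarrow> nat) \<Rightarrow> 'w set"
  assumes "finite_measure \<nu>" and A: "\<And>n z. A n z \<in> sets \<nu>" and fin: "\<And>n. finitely_determined (A n)"
  shows "{\<omega>. \<exists>z. \<forall>n. \<omega> \<in> A n z} \<in> sets (completion \<nu>)"
proof (rule sets_completion_if_inner_approx)
  interpret finite_measure \<nu> by fact
  show "finite_measure \<nu>" by fact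
  define B where "B S = {\<omega>. \<exists>z\<in>S. \<forall>n. \<omega> \<in> A n z}" for S
  have B_space: "B S \<subseteq> space \<nu>" for S
    using A[THEN sets.sets_into_space] by (auto simp: B_def)
  have B_UNIV: "{\<omega>. \<exists>z. \<forall>n. \<omega> \<in> A n z} = B UNIV" by (auto simp: B_def)
  show "{\<omega>. \<exists>z. \<forall>n. \<omega> \<in> A n z} \<subseteq> space \<nu>" unfolding B_UNIV by (rule B_space)
  fix r assume "r < outer_measure_of \<nu> {\<omega>. \<exists>z. \<forall>n. \<omega> \<in> A n z}"
  then have r: "r < outer_measure_of \<nu> (B UNIV)" unfolding B_UNIV .
  have step: "\<exists>S'. r < outer_measure_of \<nu> (B S') \<and> (\<exists>k. S' = S \<inter> {z. z n \<le> k})"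
    if "r < outer_measure_of \<nu> (B S)" for S n
  proof -
    \<comment> \<open>Letting \<open>k\<close> grow exhausts \<open>S\<close>, and outer measure is
      continuous from below along increasing sequences of arbitrary sets.\<close>
    have "B S = (\<Union>k. B (S \<inter> {z. z n \<le> k}))" by (auto simp: B_def)
    moreover have "incseq (\<lambda>k. B (S \<inter> {z. z n \<le> k}))"
      by (fastforce simp: incseq_def B_def)
    ultimately have "outer_measure_of \<nu> (B S) = (SUP k. outer_measure_of \<nu> (B (S \<inter> {z. z n \<le> k})))"
      using SUP_outer_measure_of_incseq[of "\<lambda>k. B (S \<inter> {z. z n \<le> k})" \<nu>] B_space by simp
    with that show ?thesis by (auto simp: less_SUP_iff)
  qed
  \<comment> \<open>Dependent choice: the clause for \<open>n = 0\<close> fixes the start, and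
    passing from \<open>S n\<close> to \<open>S (Suc n)\<close> bounds coordinate
    \<open>n\<close>.\<close>
  have "\<exists>S. \<forall>n. (r < outer_measure_of \<nu> (B (S n)) \<and> (n = 0 \<longrightarrow> S n = UNIV)) \<and>
      (\<exists>k. S (Suc n) = S n \<inter> {z. z n \<le> k})"
    by (rule dependent_nat_choice) (use r step in auto)
  then obtain S where S: "\<And>n. r < outer_measure_of \<nu> (B (S n))" "S 0 = UNIV"
      "\<And>n. \<exists>k. S (Suc n) = S n \<inter> {z. z n \<le> k}"
    by metis
  obtain k where k: "\<And>n. S (Suc n) = S n \<inter> {z. z n \<le> k n}" using S(3) by metis
  have S_box: "S n = {z. \<forall>i<n. z i \<le> k i}" for n
    by (induction n) (auto simp: S(2) k less_Suc_eq)
  define box where "box = {z. \<forall>i. z i \<le> k i}"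
  define D where "D m = {\<omega>. \<exists>z\<in>box. \<forall>j\<in>{..m}. \<omega> \<in> A j z}" for m :: nat
  \<comment> \<open>The filler 0 respects every bound \<open>k i\<close>, so truncating a branch of
    \<open>S N\<close>, bounded below \<open>N\<close> only, leads into \<open>box\<close>.\<close>
  define trunc where "trunc N z = (\<lambda>i::nat. if i < N then z i else (0::nat))" for N z
  have trunc: "\<exists>N. \<forall>z. \<forall>j\<in>{..m}. A j (trunc N z) = A j z" for m
  proof -
    obtain N where N: "\<And>z z'. (\<forall>i<N. z i = z' i) \<Longrightarrow> (\<lambda>j\<in>{..m}. A j z) = (\<lambda>j\<in>{..m}. A j z')"
      using finitely_determined_restrict[of A m] fin unfolding finitely_determined_def by blast
    have "A j (trunc N z) = A j z" if "j \<in> {..m}" for z j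
      using N[of "trunc N z" z] that by (auto simp: trunc_def fun_eq_iff restrict_def split: if_splits)
    then show ?thesis by blast
  qed
  have D_sets: "D m \<in> sets \<nu>" for m
  proof -
    obtain N where N: "\<And>z j. j \<in> {..m} \<Longrightarrow> A j (trunc N z) = A j z" using trunc by blast
    \<comment> \<open>Finite lists yield all truncations, so the countable set \<open>T\<close>
      represents every branch of \<open>box\<close> as far as the conditions up to \<open>m\<close>
      can see.\<close>
    define T where "T = range (\<lambda>l. trunc N (\<lambda>i. l ! i)) \<inter> box"
    have "D m = (\<Union>z\<in>T. \<Inter>j\<in>{..m}. A j z)"
    proof (intro equalityI subsetI)
      fix \<omega> assume "\<omega> \<in> D m"
      then obtain z where z: "z \<in> box" "\<And>j. j \<in> {..m} \<Longrightarrow> \<omega> \<in> A j z" by (auto simp: D_def)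
      have "trunc N z = trunc N (\<lambda>i. map z [0..<N] ! i)" by (auto simp: trunc_def)
      then have "trunc N z \<in> T" using z(1) unfolding T_def by (auto simp: box_def trunc_def)
      then show "\<omega> \<in> (\<Union>z\<in>T. \<Inter>j\<in>{..m}. A j z)" using z N by blast
    qed (auto simp: D_def T_def)
    moreover have "countable T" unfolding T_def by (intro countable_Int1 countable_image) auto
    ultimately show ?thesis using A by auto
  qed
  have dec: "decseq D" by (fastforce simp: decseq_def D_def)
  have r_D: "r \<le> emeasure \<nu> (D m)" for m
  proof -
    obtain N where N: "\<And>z j. j \<in> {..m} \<Longrightarrow> A j (trunc N z) = A j z" using trunc by blast
    have "B (S N) \<subseteq> D m"
    proof
      fix \<omega> assume "\<omega> \<in> B (S N)"
      then obtain z where z: "z \<in> S N" "\<And>n. \<omega> \<in> A n z" by (auto simp: B_def)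
      have "trunc N z \<in> box" using z(1) by (auto simp: S_box box_def trunc_def)
      then show "\<omega> \<in> D m" using z(2) N by (auto simp: D_def intro!: bexI[of _ "trunc N z"])
    qed
    then have "outer_measure_of \<nu> (B (S N)) \<le> emeasure \<nu> (D m)"
      using outer_measure_of_mono[of "B (S N)" "D m" \<nu>] D_sets by simp
    then show ?thesis using S(1)[of N] by simp
  qed
  have "emeasure \<nu> (\<Inter>m. D m) = (INF m. emeasure \<nu> (D m))"
    by (rule INF_emeasure_decseq[symmetric]) (use D_sets dec in auto)
  then have "r \<le> emeasure \<nu> (\<Inter>m. D m)" using r_D by (auto intro: INF_greatest)
  moreover have "(\<Inter>m. D m) \<subseteq> B UNIV"
  proof
    fix \<omega> assume "\<omega> \<in> (\<Inter>m. D m)"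
    then have "\<forall>m. \<exists>z\<in>box. \<forall>j\<in>{..m}. \<omega> \<in> A j z" by (auto simp: D_def)
    then obtain x where x: "\<And>m. x m \<in> box" "\<And>m j. j \<le> m \<Longrightarrow> \<omega> \<in> A j (x m)"
      by (metis atMost_iff)
    \<comment> \<open>A limit \<open>y\<close> of witnesses for more and more conditions is a
      witness for all of them: each \<open>A j\<close> sees finitely many coordinates, and there the
      subsequence eventually agrees with \<open>y\<close>.\<close>
    have "seq_compact box" using compact_nat_box[of k] unfolding box_def by (simp add: compact_imp_seq_compact)
    then obtain y \<sigma> where y: "strict_mono \<sigma>" "(x \<circ> \<sigma>) \<longlonglongrightarrow> y"
      using x(1) unfolding seq_compact_def by metis
    have "\<omega> \<in> A j y" for j
    proof -
      obtain N where N: "\<And>z z'. (\<forall>i<N. z i = z' i) \<Longrightarrow> A j z = A j z'"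
        using fin unfolding finitely_determined_def by blast
      have "\<forall>\<^sub>F n in sequentially. (\<forall>i<N. (x \<circ> \<sigma>) n i = y i) \<and> j \<le> n"
        by (intro eventually_conj eventually_agree_below y eventually_ge_at_top)
      then obtain n where n: "\<forall>i<N. x (\<sigma> n) i = y i" "j \<le> n"
        by (auto simp: eventually_sequentially)
      have "j \<le> \<sigma> n" using n(2) seq_suble[OF y(1), of n] by linarith
      then show ?thesis using x(2) N[OF n(1)] by blast
    qed
    then show "\<omega> \<in> B UNIV" by (auto simp: B_def)
  qed
  ultimately show "\<exists>L\<in>sets \<nu>. L \<subseteq> {\<omega>. \<exists>z. \<forall>n. \<omega> \<in> A n z} \<and> r \<le> emeasure \<nu> L"
    unfolding B_UNIV using D_sets by (intro bexI[of _ "\<Inter>m. D m"]) auto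
qed

section \<open>Souslin sets over the Baire space and their closure properties\<close>

text \<open>Only the finitely many positions \<open>p i\<close> with \<open>i < N\<close> are
  read.\<close>

lemma finitely_determined_reindex:
  assumes "finitely_determined A"
  shows "finitely_determined (\<lambda>y. A (\<lambda>k. y (p k)))"
proof -
  obtain N where N: "\<And>z z'. (\<forall>i<N. z i = z' i) \<Longrightarrow> A z = A z'"
    using assms unfolding finitely_determined_def by blast
  have "A (\<lambda>k. y (p k)) = A (\<lambda>k. y' (p k))" if "\<forall>i<Suc (Max (p ` {..<N})). y i = y' i" for y y'
  proof (intro N allI impI)
    fix i assume "i < N"
    then have "p i < Suc (Max (p ` {..<N}))" by (simp add: less_Suc_eq_le)
    with that show "y (p i) = y' (p i)" by blast
  qed
  then show ?thesis unfolding finitely_determined_def by blast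
qed

lemma finitely_determined_if:
  assumes "finitely_determined A"
  shows "finitely_determined (\<lambda>y. if P (y i) then A y else C)"
proof -
  obtain N where N: "\<And>z z'. (\<forall>i<N. z i = z' i) \<Longrightarrow> A z = A z'"
    using assms unfolding finitely_determined_def by blast
  have "(if P (y i) then A y else C) = (if P (y' i) then A y' else C)"
    if "\<forall>j<max N (Suc i). y j = y' j" for y y'
    using that N[of y y'] by auto
  then show ?thesis unfolding finitely_determined_def by blast
qed

lemma finitely_determined_const: "finitely_determined (\<lambda>y. C)"
  by (auto simp: finitely_determined_def)

definition interleave :: "(nat \<Rightarrow> 'a) \<Rightarrow> (nat \<Rightarrow> 'a) \<Rightarrow> nat \<Rightarrow> 'a" where
  "interleave z w k = (if even k then z (k div 2) else w (k div 2))"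

lemma interleave_surj: "interleave (\<lambda>k. y (2 * k)) (\<lambda>k. y (2 * k + 1)) = y"
  by (auto simp: interleave_def fun_eq_iff)

lemma ex_interleave_iff: "(\<exists>z w. P (interleave z w)) \<longleftrightarrow> (\<exists>y. P y)"
  by (metis interleave_surj)

text \<open>The even coordinates of a branch carry the point \<open>z\<close>, the odd ones an
  existential witness \<open>w\<close>. Projecting away \<open>z\<close> merely makes it part of the
  witness.\<close>

definition souslin_in :: "'w measure \<Rightarrow> ('w \<times> (nat \<Rightarrow> nat)) set \<Rightarrow> bool" where
  "souslin_in M G \<longleftrightarrow>
     (\<exists>A :: nat \<Rightarrow> (nat \<Rightarrow> nat) \<Rightarrow> 'w set. (\<forall>n z. A n z \<in> sets M) \<and> (\<forall>n. finitely_determined (A n)) \<and>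
        G = {(\<omega>, z). \<exists>w. \<forall>n. \<omega> \<in> A n (interleave z w)})"

lemma souslin_inI:
  assumes "\<And>n z. A n z \<in> sets M" "\<And>n. finitely_determined (A n)"
    "G = {(\<omega>, z). \<exists>w. \<forall>n::nat. \<omega> \<in> A n (interleave z w)}"
  shows "souslin_in M G"
  using assms unfolding souslin_in_def by blast

text \<open>Witnesses for all \<open>j\<close> are stored in a single \<open>w\<close> as its
  columns \<open>\<lambda>m. w (prod_encode (j, m))\<close>, and the conditions of all schemes are
  listed in one sequence.\<close>

lemma souslin_in_INT:
  assumes "\<And>j::nat. souslin_in M (G j)"
  shows "souslin_in M (\<Inter>j. G j)"
proof -
  have "\<forall>j. souslin_in M (G j)" using assms by blast
  from choice[OF this[unfolded souslin_in_def]] obtain A :: "nat \<Rightarrow> nat \<Rightarrow> (nat \<Rightarrow> nat) \<Rightarrow> 'a set"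
    where rep: "\<forall>j. (\<forall>n z. A j n z \<in> sets M) \<and> (\<forall>n. finitely_determined (A j n)) \<and>
      G j = {(\<omega>, z). \<exists>w. \<forall>n. \<omega> \<in> A j n (interleave z w)}"
    by (rule exE)
  note A = rep[THEN spec, THEN conjunct1, rule_format] rep[THEN spec, THEN conjunct2, THEN conjunct1, rule_format]
    and G = rep[THEN spec, THEN conjunct2, THEN conjunct2]
  \<comment> \<open>The \<open>j\<close>-th scheme reads \<open>z\<close> in place and takes its own
    witness from column \<open>j\<close> of \<open>w\<close>.\<close>
  define p where "p j k = (if even k then k else 2 * prod_encode (j, k div 2) + 1)" for j k :: nat
  have p: "(\<lambda>k. interleave z w (p j k)) = interleave z (\<lambda>m. w (prod_encode (j, m)))" for z w :: "nat \<Rightarrow> nat" and j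
    by (auto simp: fun_eq_iff interleave_def p_def)
  define A' where "A' i y = (case prod_decode i of (j, n) \<Rightarrow> A j n (\<lambda>k. y (p j k)))" for i y
  show ?thesis
  proof (rule souslin_inI)
    show "A' n z \<in> sets M" for n z using A(1) by (auto simp: A'_def split: prod.split)
    show "finitely_determined (A' n)" for n
      unfolding A'_def by (cases "prod_decode n") (auto intro: finitely_determined_reindex A(2))
    have A'_iff: "(\<forall>i. \<omega> \<in> A' i (interleave z w)) \<longleftrightarrow>
        (\<forall>j n. \<omega> \<in> A j n (interleave z (\<lambda>m. w (prod_encode (j, m)))))" for \<omega> z w
    proof -
      have "(\<forall>i. \<omega> \<in> A' i (interleave z w)) \<longleftrightarrow> (\<forall>j n. \<omega> \<in> A' (prod_encode (j, n)) (interleave z w))"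
        by (metis prod_decode_inverse surj_pair)
      then show ?thesis by (simp add: A'_def p)
    qed
    have choice: "(\<exists>w. \<forall>j n. \<omega> \<in> A j n (interleave z (\<lambda>m. w (prod_encode (j, m))))) \<longleftrightarrow>
        (\<forall>j. \<exists>v. \<forall>n. \<omega> \<in> A j n (interleave z v))" for \<omega> z
    proof
      assume "\<forall>j. \<exists>v. \<forall>n. \<omega> \<in> A j n (interleave z v)"
      then obtain v where v: "\<And>j n. \<omega> \<in> A j n (interleave z (v j))" by metis
      show "\<exists>w. \<forall>j n. \<omega> \<in> A j n (interleave z (\<lambda>m. w (prod_encode (j, m))))"
        using v by (intro exI[of _ "\<lambda>i. case prod_decode i of (j, m) \<Rightarrow> v j m"]) simp
    qed blast
    show "(\<Inter>j. G j) = {(\<omega>, z). \<exists>w. \<forall>n. \<omega> \<in> A' n (interleave z w)}"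
      unfolding A'_iff choice G by auto
  qed
qed

text \<open>The new witness starts with an entry \<open>w 0\<close> naming a member \<open>j\<close>
  of the union and continues with a witness for \<open>G j\<close>.\<close>

lemma souslin_in_UN:
  assumes "\<And>j::nat. souslin_in M (G j)"
  shows "souslin_in M (\<Union>j. G j)"
proof -
  have "\<forall>j. souslin_in M (G j)" using assms by blast
  from choice[OF this[unfolded souslin_in_def]] obtain A :: "nat \<Rightarrow> nat \<Rightarrow> (nat \<Rightarrow> nat) \<Rightarrow> 'a set"
    where rep: "\<forall>j. (\<forall>n z. A j n z \<in> sets M) \<and> (\<forall>n. finitely_determined (A j n)) \<and>
      G j = {(\<omega>, z). \<exists>w. \<forall>n. \<omega> \<in> A j n (interleave z w)}"
    by (rule exE)
  note A = rep[THEN spec, THEN conjunct1, rule_format] rep[THEN spec, THEN conjunct2, THEN conjunct1, rule_format]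
    and G = rep[THEN spec, THEN conjunct2, THEN conjunct2]
  \<comment> \<open>The entry \<open>w 0\<close> sits at position 1 of the branch; moving odd
    positions by 2 skips it.\<close>
  define p where "p k = (if even k then k else k + 2)" for k :: nat
  have p: "(\<lambda>k. interleave z w (p k)) = interleave z (\<lambda>m. w (Suc m))" for z w :: "nat \<Rightarrow> nat"
    by (auto simp: fun_eq_iff interleave_def p_def)
  \<comment> \<open>The simpler choice \<open>A (y 1) n\<close> need not be finitely determined, hence \<open>j\<close> is also coded into \<open>i\<close>.\<close>
  define A' where "A' i y = (case prod_decode i of (j, n) \<Rightarrow>
      if y 1 = j then A j n (\<lambda>k. y (p k)) else space M)" for i and y :: "nat \<Rightarrow> nat"
  show ?thesis
  proof (rule souslin_inI)
    show "A' n z \<in> sets M" for n z using A(1) by (auto simp: A'_def split: prod.split)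
    show "finitely_determined (A' n)" for n
      unfolding A'_def prod.case_eq_if
      by (rule finitely_determined_if[where P = "\<lambda>k. k = fst (prod_decode n)" and i = 1],
          rule finitely_determined_reindex, rule A(2))
    \<comment> \<open>For \<open>j\<close> other than \<open>w 0\<close> only membership in
      \<open>space M\<close> is demanded, and the conditions for \<open>w 0\<close> imply
      it.\<close>
    have A_space: "\<omega> \<in> space M" if "\<omega> \<in> A j n z" for \<omega> j n z
      using that A(1) sets.sets_into_space by blast
    have A'_iff: "(\<forall>i. \<omega> \<in> A' i (interleave z w)) \<longleftrightarrow>
        (\<forall>n. \<omega> \<in> A (w 0) n (interleave z (\<lambda>m. w (Suc m))))" for \<omega> z w
    proof -
      have "(\<forall>i. \<omega> \<in> A' i (interleave z w)) \<longleftrightarrow> (\<forall>j n. \<omega> \<in> A' (prod_encode (j, n)) (interleave z w))"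
        by (metis prod_decode_inverse surj_pair)
      also have "\<dots> \<longleftrightarrow> (\<forall>j n. \<omega> \<in> (if w 0 = j then A j n (interleave z (\<lambda>m. w (Suc m))) else space M))"
        unfolding A'_def prod_encode_inverse prod.case p by (simp add: interleave_def)
      also have "\<dots> \<longleftrightarrow> (\<forall>n. \<omega> \<in> A (w 0) n (interleave z (\<lambda>m. w (Suc m))))"
        by (metis A_space)
      finally show ?thesis .
    qed
    have "(\<exists>w. \<forall>n. \<omega> \<in> A (w 0) n (interleave z (\<lambda>m. w (Suc m)))) \<longleftrightarrow>
        (\<exists>j v. \<forall>n. \<omega> \<in> A j n (interleave z v))" for \<omega> z
    proof
      assume "\<exists>j v. \<forall>n. \<omega> \<in> A j n (interleave z v)"
      then obtain j v where v: "\<And>n. \<omega> \<in> A j n (interleave z v)" by metis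
      show "\<exists>w. \<forall>n. \<omega> \<in> A (w 0) n (interleave z (\<lambda>m. w (Suc m)))"
        using v by (intro exI[of _ "case_nat j v"]) simp
    qed blast
    then show "(\<Union>j. G j) = {(\<omega>, z). \<exists>w. \<forall>n. \<omega> \<in> A' n (interleave z w)}"
      unfolding A'_iff G by auto
  qed
qed

text \<open>Serves for cylinders and their complements. Position \<open>2 * i\<close> of the branch
  holds \<open>z i\<close>.\<close>

lemma souslin_in_if:
  assumes "A \<in> sets M" "C \<in> sets M"
  shows "souslin_in M {(\<omega>, z). \<omega> \<in> (if P (z i) then A else C)}"
proof (rule souslin_inI)
  show "(\<lambda>_ y. if P (y (2 * i)) then A else C) n z \<in> sets M" for n :: nat and z
    using assms by auto
  show "finitely_determined ((\<lambda>_ y. if P (y (2 * i)) then A else C) n)" for n :: nat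
    by (intro finitely_determined_if finitely_determined_const)
  show "{(\<omega>, z). \<omega> \<in> (if P (z i) then A else C)} =
      {(\<omega>, z). \<exists>w. \<forall>n::nat. \<omega> \<in> (\<lambda>_ y. if P (y (2 * i)) then A else C) n (interleave z w)}"
    by (simp add: interleave_def)
qed

section \<open>Measurable sets as Souslin sets, and projection along the Baire space\<close>

text \<open>Allows measurability into the Baire space to be checked on single coordinates.\<close>

lemma sets_borel_nat_seq:
  "sets (borel :: (nat \<Rightarrow> nat) measure) = sets (\<Pi>\<^sub>M i\<in>UNIV. count_space UNIV)"
proof -
  have "sets (\<Pi>\<^sub>M i\<in>(UNIV::nat set). (borel :: nat measure)) = sets (\<Pi>\<^sub>M i\<in>UNIV. count_space UNIV)"
    by (rule sets_PiM_cong) (simp_all add: sets_borel_eq_count_space)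
  then show ?thesis by (simp add: sets_PiM_equal_borel)
qed

text \<open>Souslin sets are closed under countable unions and intersections, so those with Souslin
  complement form a \<sigma>-algebra. It contains the cylinders and hence all measurable
  sets.\<close>

lemma souslin_in_if_measurable:
  assumes "G \<in> sets (M \<Otimes>\<^sub>M (borel :: (nat \<Rightarrow> nat) measure))"
  shows "souslin_in M G"
proof -
  let ?\<Omega> = "space M \<times> (UNIV :: (nat \<Rightarrow> nat) set)"
  define \<Sigma> where "\<Sigma> = {G. G \<subseteq> ?\<Omega> \<and> souslin_in M G \<and> souslin_in M (?\<Omega> - G)}"
  have cyl: "{(\<omega>, z). \<omega> \<in> A \<and> P (z i)} \<in> \<Sigma>" if A: "A \<in> sets M" for A i and P :: "nat \<Rightarrow> bool"
  proof -
    have "{(\<omega>, z). \<omega> \<in> (if P (z i) then A else {})} = {(\<omega>, z). \<omega> \<in> A \<and> P (z i)}"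
      by auto
    \<comment> \<open>The complement of a cylinder has the same shape: \<open>space M - A\<close>
      where \<open>P\<close> holds, all of \<open>space M\<close> elsewhere.\<close>
    moreover have "{(\<omega>, z). \<omega> \<in> (if P (z i) then space M - A else space M)} = ?\<Omega> - {(\<omega>, z). \<omega> \<in> A \<and> P (z i)}"
      by (auto split: if_splits)
    ultimately show ?thesis
      using souslin_in_if[of A M "{}" P i] souslin_in_if[of "space M - A" M "space M" P i] A
      by (auto simp: \<Sigma>_def dest: sets.sets_into_space)
  qed
  have "sigma_algebra ?\<Omega> \<Sigma>"
    unfolding sigma_algebra_iff2
  proof (intro conjI ballI allI impI)
    show "\<Sigma> \<subseteq> Pow ?\<Omega>" by (auto simp: \<Sigma>_def)
    show "{} \<in> \<Sigma>" using cyl[of "{}"] by simp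
    show "?\<Omega> - G \<in> \<Sigma>" if "G \<in> \<Sigma>" for G
      using that by (auto simp: \<Sigma>_def double_diff)
    show "(\<Union>j. G j) \<in> \<Sigma>" if "range G \<subseteq> \<Sigma>" for G :: "nat \<Rightarrow> _"
    proof -
      have G: "G j \<subseteq> ?\<Omega>" "souslin_in M (G j)" "souslin_in M (?\<Omega> - G j)" for j
        using that by (auto simp: \<Sigma>_def)
      have "?\<Omega> - (\<Union>j. G j) = (\<Inter>j. ?\<Omega> - G j)" by auto
      then show ?thesis using G souslin_in_UN[of M G] souslin_in_INT[of M "\<lambda>j. ?\<Omega> - G j"]
        by (auto simp: \<Sigma>_def)
    qed
  qed
  \<comment> \<open>Over the \<sigma>-algebra \<Sigma> both projections are measurable, hence so is
    the identity into the product, which is the inclusion sought.\<close>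
  define N where "N = sigma ?\<Omega> \<Sigma>"
  have sets_N: "sets N = \<Sigma>" and space_N: "space N = ?\<Omega>"
    unfolding N_def by (simp_all add: \<open>sigma_algebra ?\<Omega> \<Sigma>\<close> sigma_algebra.sets_measure_of_eq)
      (metis \<open>sigma_algebra ?\<Omega> \<Sigma>\<close> sigma_algebra.space_measure_of_eq)
  have "fst \<in> N \<rightarrow>\<^sub>M M"
  proof (rule measurableI)
    fix A assume "A \<in> sets M"
    moreover have "fst -` A \<inter> space N = {(\<omega>, z). \<omega> \<in> A \<and> True}"
      using \<open>A \<in> sets M\<close>[THEN sets.sets_into_space] by (auto simp: space_N)
    ultimately show "fst -` A \<inter> space N \<in> sets N" using cyl[of A "\<lambda>_. True"] by (simp add: sets_N)
  qed (auto simp: space_N)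
  moreover have "snd \<in> N \<rightarrow>\<^sub>M (\<Pi>\<^sub>M i\<in>UNIV. count_space UNIV)"
  proof (rule measurable_PiM_single)
    fix B :: "nat set" and i :: nat
    have "{x \<in> space N. snd x i \<in> B} = {(\<omega>, z). \<omega> \<in> space M \<and> z i \<in> B}"
      by (auto simp: space_N)
    then show "{x \<in> space N. snd x i \<in> B} \<in> sets N" using cyl[of "space M"] by (simp add: sets_N)
  qed auto
  then have "snd \<in> N \<rightarrow>\<^sub>M borel" using measurable_cong_sets[OF refl sets_borel_nat_seq] by blast
  ultimately have "(\<lambda>x. (fst x, snd x)) \<in> N \<rightarrow>\<^sub>M M \<Otimes>\<^sub>M borel" by (rule measurable_Pair)
  from measurable_sets[OF this assms] have "G \<inter> space N \<in> \<Sigma>" by (simp add: sets_N)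
  moreover have "G \<subseteq> space N" using assms sets.sets_into_space by (fastforce simp: space_N space_pair_measure)
  ultimately show ?thesis by (simp add: \<Sigma>_def Int_absorb2)
qed

text \<open>Quantifying over \<open>z\<close> and \<open>w\<close> amounts to quantifying over the
  interleaved branch, so the projection results from the Souslin operation.\<close>

lemma projection_along_nat_seq_universally_measurable:
  assumes "G \<in> sets (M \<Otimes>\<^sub>M (borel :: (nat \<Rightarrow> nat) measure))"
  shows "fst ` G \<in> universally_measurable_sets M"
proof -
  obtain A :: "nat \<Rightarrow> (nat \<Rightarrow> nat) \<Rightarrow> 'a set"
    where A: "\<And>n z. A n z \<in> sets M" "\<And>n. finitely_determined (A n)"
      and G: "G = {(\<omega>, z). \<exists>w. \<forall>n. \<omega> \<in> A n (interleave z w)}"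
    using souslin_in_if_measurable[OF assms] unfolding souslin_in_def by blast
  have "fst ` G = {\<omega>. \<exists>z w. \<forall>n. \<omega> \<in> A n (interleave z w)}" unfolding G by force
  then have "fst ` G = {\<omega>. \<exists>y. \<forall>n. \<omega> \<in> A n y}"
    unfolding ex_interleave_iff[of "\<lambda>y. \<forall>n. _ \<in> A n y"] .
  then show ?thesis
    unfolding universally_measurable_sets_iff using souslin_operation_sets_completion A by metis
qed

section \<open>Nonempty Polish spaces as continuous images of the Baire space\<close>

lemma open_nat_seq_cylinder: "open {z' :: nat \<Rightarrow> nat. \<forall>i\<le>n. z' i = z i}"
proof -
  have "open ((\<lambda>z' :: nat \<Rightarrow> nat. z' i) -` {z i})" for i
    by (rule open_vimage) (auto intro: open_discrete)
  then have "open (\<Inter>i\<in>{..n}. (\<lambda>z' :: nat \<Rightarrow> nat. z' i) -` {z i})" by auto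
  also have "(\<Inter>i\<in>{..n}. (\<lambda>z' :: nat \<Rightarrow> nat. z' i) -` {z i}) = {z'. \<forall>i\<le>n. z' i = z i}" by auto
  finally show ?thesis .
qed

text \<open>With \<open>e\<close> enumerating a dense set, \<open>z n\<close> proposes
  \<open>e (z n)\<close> as the \<open>n\<close>-th approximation. Proposals too far from the
  previous approximation are refused, so every branch gives a Cauchy sequence, whose limit is
  \<open>\<phi> z\<close>.\<close>

lemma Polish_topology_image_of_nat_seq:
  assumes "Polish_topology P" and ne: "topspace P \<noteq> {}"
  obtains \<phi> :: "(nat \<Rightarrow> nat) \<Rightarrow> 'p" where "continuous_map euclidean P \<phi>" "range \<phi> = topspace P"
proof -
  from assms obtain M d where MS: "Metric_space M d" and compl: "Metric_space.mcomplete M d"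
    and P: "P = Metric_space.mtopology M d" and sc: "second_countable P"
    unfolding Polish_topology_def completely_metrizable_space_def by blast
  interpret Metric_space M d by fact
  obtain D where D: "countable D" "D \<subseteq> M" "mtopology closure_of D = M"
    using second_countable_imp_separable_space[OF sc] unfolding separable_space_def P by auto
  have "D \<noteq> {}" using D(3) ne by (auto simp: P)
  define e where "e = from_nat_into D"
  have e: "range e = D" unfolding e_def using \<open>D \<noteq> {}\<close> D(1) by (rule range_from_nat_into)
  then have eM: "e k \<in> M" for k using D(2) by blast
  have dense: "\<exists>k. d p (e k) < r" if "p \<in> M" "0 < r" for p r
  proof -
    have "p \<in> mtopology closure_of D" using that D(3) by simp
    then obtain y where "y \<in> D" "y \<in> mball p r" using \<open>0 < r\<close> unfolding metric_closure_of by blast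
    then show ?thesis using e by auto
  qed
  \<comment> \<open>A refused proposal repeats the previous point, which keeps the
    \<open>n\<close>-th step at most \<open>(1/2)^n\<close> on every branch.\<close>
  define a where "a z = rec_nat (e (z 0)) (\<lambda>n x. if d x (e (z (Suc n))) \<le> (1/2)^n then e (z (Suc n)) else x)" for z
  have a0: "a z 0 = e (z 0)"
    and aSuc: "a z (Suc n) = (if d (a z n) (e (z (Suc n))) \<le> (1/2)^n then e (z (Suc n)) else a z n)" for z n
    by (simp_all add: a_def)
  have aM: "a z n \<in> M" for z n by (induction n) (auto simp: a0 aSuc eM)
  have a_step: "d (a z n) (a z (Suc n)) \<le> (1/2)^n" for z n using aM[of z n] by (simp add: aSuc)
  \<comment> \<open>The bound is the geometric sum of the step bounds in closed form, suited to
    induction on \<open>m\<close>.\<close>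
  have a_add: "d (a z n) (a z (n + m)) \<le> 2 * (1/2)^n - 2 * (1/2)^(n + m)" for z n m
  proof (induction m)
    case (Suc m)
    have "d (a z n) (a z (n + Suc m)) \<le> d (a z n) (a z (n + m)) + d (a z (n + m)) (a z (n + Suc m))"
      using aM by (intro triangle)
    also have "d (a z (n + m)) (a z (n + Suc m)) \<le> (1/2)^(n + m)" using a_step[of z "n + m"] by simp
    finally show ?case using Suc by simp
  qed (simp add: aM)
  have a_le: "d (a z n) (a z m) \<le> 2 * (1/2)^n" if "n \<le> m" for z n m
  proof -
    have "d (a z n) (a z m) \<le> 2 * (1/2)^n - 2 * (1/2)^m" using a_add[of z n "m - n"] that by simp
    then show ?thesis by (smt (verit) zero_le_power divide_nonneg_nonneg)
  qed
  have small: "\<exists>n. c * (1/2)^n < r" if "0 < r" for r c :: real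
  proof -
    have "(\<lambda>n. c * (1/2)^n) \<longlonglongrightarrow> c * 0" by (intro tendsto_intros LIMSEQ_realpow_zero) auto
    then have "\<forall>\<^sub>F n in sequentially. c * (1/2)^n < r" using that by (simp add: order_tendstoD(2))
    then show ?thesis by (auto simp: eventually_sequentially)
  qed
  have "MCauchy (a z)" for z
    unfolding MCauchy_def
  proof (intro conjI allI impI)
    show "range (a z) \<subseteq> M" using aM by auto
    fix r :: real assume "0 < r"
    then obtain N where N: "4 * (1/2)^N < r" using small by blast
    have "d (a z n) (a z n') < r" if "N \<le> n" "N \<le> n'" for n n'
    proof -
      have "d (a z n) (a z n') \<le> d (a z N) (a z n) + d (a z N) (a z n')"
        by (rule triangle'') (use aM in auto)
      then show ?thesis using a_le[OF that(1), of z] a_le[OF that(2), of z] N by linarith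
    qed
    then show "\<exists>N. \<forall>n n'. N \<le> n \<longrightarrow> N \<le> n' \<longrightarrow> d (a z n) (a z n') < r" by blast
  qed
  then have "\<exists>l. limitin mtopology (a z) l sequentially" for z
    using compl unfolding mcomplete_def by blast
  then obtain \<phi> where \<phi>: "\<And>z. limitin mtopology (a z) (\<phi> z) sequentially" by metis
  have \<phi>M: "\<phi> z \<in> M" for z using \<phi>[of z] by (simp add: limit_metric_sequentially)
  have a_\<phi>: "d (a z n) (\<phi> z) \<le> 2 * (1/2)^n" for z n
  proof (rule field_le_epsilon)
    fix r :: real assume "0 < r"
    then obtain N where N: "\<And>m. m \<ge> N \<Longrightarrow> d (a z m) (\<phi> z) < r"
      using \<phi>[of z] unfolding limit_metric_sequentially by blast
    have "d (a z n) (\<phi> z) \<le> d (a z n) (a z (max n N)) + d (a z (max n N)) (\<phi> z)"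
      using aM \<phi>M by (intro triangle)
    then show "d (a z n) (\<phi> z) \<le> 2 * (1/2)^n + r"
      using N[of "max n N"] a_le[of n "max n N" z] by simp
  qed
  \<comment> \<open>Branches agreeing up to \<open>n\<close> share the \<open>n\<close>-th
    approximation, so their limits differ by at most \<open>4 * (1/2)^n\<close>. This gives
    continuity.\<close>
  have a_cong: "a z n = a z' n" if "\<forall>i\<le>n. z' i = z i" for z z' n
    using that by (induction n) (auto simp: a0 aSuc)
  have "continuous_map euclidean P \<phi>"
    unfolding continuous_map_def
  proof (intro conjI allI impI)
    show "\<phi> \<in> topspace euclidean \<rightarrow> topspace P" using \<phi>M by (auto simp: P)
    fix U assume U: "openin P U"
    have "\<exists>T. open T \<and> z \<in> T \<and> T \<subseteq> {z. \<phi> z \<in> U}" if z: "\<phi> z \<in> U" for z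
    proof -
      obtain r where r: "0 < r" "mball (\<phi> z) r \<subseteq> U" using U z unfolding P openin_mtopology by blast
      obtain n where n: "4 * (1/2)^n < r" using small r(1) by blast
      have "\<phi> z' \<in> U" if "\<forall>i\<le>n. z' i = z i" for z'
      proof -
        have "d (\<phi> z) (\<phi> z') \<le> d (a z n) (\<phi> z) + d (a z n) (\<phi> z')"
          by (rule triangle'') (use aM \<phi>M in auto)
        also have "\<dots> < r" using a_\<phi>[of z n] a_\<phi>[of z' n] n by (simp add: a_cong[OF that])
        finally show ?thesis using r(2) \<phi>M by auto
      qed
      then show ?thesis using open_nat_seq_cylinder[of n z] by (intro exI[of _ "{z'. \<forall>i\<le>n. z' i = z i}"]) auto
    qed
    then have "open {z. \<phi> z \<in> U}" by (subst open_subopen) auto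
    then show "openin euclidean {x \<in> topspace euclidean. \<phi> x \<in> U}" by simp
  qed
  moreover have "range \<phi> = topspace P"
  proof
    show "topspace P \<subseteq> range \<phi>"
    proof
      fix p assume "p \<in> topspace P"
      then have p: "p \<in> M" by (simp add: P)
      \<comment> \<open>With the exponent \<open>Suc n\<close>, consecutive proposals are within
        \<open>(1/2)^n\<close> of each other, so none is refused.\<close>
      have "\<forall>n. \<exists>k. d p (e k) < (1/2)^Suc n" by (intro allI dense[OF p] zero_less_power) simp
      then obtain z where z: "\<And>n. d p (e (z n)) < (1/2)^Suc n" by metis
      have a_z: "a z n = e (z n)" for n
      proof (induction n)
        case (Suc n)
        have "d (e (z n)) (e (z (Suc n))) \<le> d p (e (z n)) + d p (e (z (Suc n)))"
          by (rule triangle'') (use p eM in auto)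
        also have "\<dots> \<le> (1/2)^Suc n + (1/2)^Suc n"
          using z[of n] z[of "Suc n"] zero_le_power[of "1/2 :: real" n] by (simp add: field_simps)
        finally show ?case by (simp add: aSuc Suc)
      qed (simp add: a0)
      have "d p (\<phi> z) < r" if r: "0 < r" for r
      proof -
        obtain n where n: "3 * (1/2)^n < r" using small r by blast
        have "d p (\<phi> z) \<le> d p (a z n) + d (a z n) (\<phi> z)" using p aM \<phi>M by (intro triangle)
        then show ?thesis
          using z[of n] a_\<phi>[of z n] n zero_le_power[of "1/2 :: real" n]
          unfolding a_z power_Suc by linarith
      qed
      then have "d p (\<phi> z) = 0" by (metis less_irrefl nonneg order_less_le)
      then show "p \<in> range \<phi>" using p \<phi>M by auto
    qed
  qed (use \<phi>M P in auto)
  ultimately show ?thesis by (rule that)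
qed

section \<open>Projection along Souslin spaces\<close>

lemma space_borel_of [simp]: "space (borel_of T) = topspace T"
proof -
  have "{U. openin T U} \<subseteq> Pow (topspace T)" using openin_subset by blast
  then show ?thesis unfolding borel_of_def by (rule space_measure_of)
qed

lemma universally_measurable_sets_sets: "A \<in> sets M \<Longrightarrow> A \<in> universally_measurable_sets M"
  by (simp add: universally_measurable_sets_iff)

text \<open>A continuous map \<psi> of the Baire space onto \<open>S\<close> pulls \<open>G\<close>
  back to a measurable set, and surjectivity preserves the projection.\<close>

theorem projection_along_souslin_space_universally_measurable:
  assumes "souslin_space TYPE('p) S" and G: "G \<in> sets (M \<Otimes>\<^sub>M borel_of (mtopology_of S))"
  shows "fst ` G \<in> universally_measurable_sets M"
proof -
  obtain P :: "'p topology" and f where P: "Polish_topology P"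
    and f: "continuous_map P (mtopology_of S) f" "f ` topspace P = mspace S"
    using assms(1) unfolding souslin_space_def by blast
  have space_S: "space (borel_of (mtopology_of S)) = mspace S"
    by simp
  have G_sub: "G \<subseteq> space M \<times> mspace S"
    using sets.sets_into_space[OF G] by (simp add: space_pair_measure space_S)
  show ?thesis
  proof (cases "topspace P = {}")
    \<comment> \<open>An empty space is no image of the Baire space; here \<open>S\<close> and
      \<open>G\<close> are empty as well.\<close>
    case True
    then have "G = {}" using G_sub f(2) by auto
    then show ?thesis by (simp add: universally_measurable_sets_sets)
  next
    case False
    then obtain \<phi> :: "(nat \<Rightarrow> nat) \<Rightarrow> 'p" where \<phi>: "continuous_map euclidean P \<phi>" "range \<phi> = topspace P"
      using Polish_topology_image_of_nat_seq[OF P] by blast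
    define \<psi> where "\<psi> = f \<circ> \<phi>"
    have cont: "continuous_map euclidean (mtopology_of S) \<psi>"
      unfolding \<psi>_def using \<phi>(1) f(1) by (rule continuous_map_compose)
    have range: "range \<psi> = mspace S" unfolding \<psi>_def image_comp[symmetric] \<phi>(2) f(2) ..
    have "\<psi> \<in> borel \<rightarrow>\<^sub>M borel_of (mtopology_of S)"
      unfolding borel_of_def
    proof (rule measurable_measure_of)
      fix U assume "U \<in> {U. openin (mtopology_of S) U}"
      then have "open {z. \<psi> z \<in> U}" using openin_continuous_map_preimage[OF cont] by auto
      then show "\<psi> -` U \<inter> space borel \<in> sets borel" by (simp add: vimage_def)
    next
      show "{U. openin (mtopology_of S) U} \<subseteq> Pow (topspace (mtopology_of S))"
        using openin_subset by blast
    qed (use range in auto)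
    then have "(\<lambda>x. (fst x, \<psi> (snd x))) \<in> M \<Otimes>\<^sub>M borel \<rightarrow>\<^sub>M M \<Otimes>\<^sub>M borel_of (mtopology_of S)"
      by measurable
    from measurable_sets[OF this G]
    have "fst ` ((\<lambda>x. (fst x, \<psi> (snd x))) -` G \<inter> space (M \<Otimes>\<^sub>M borel)) \<in> universally_measurable_sets M"
      by (rule projection_along_nat_seq_universally_measurable)
    also have "fst ` ((\<lambda>x. (fst x, \<psi> (snd x))) -` G \<inter> space (M \<Otimes>\<^sub>M borel)) = fst ` G"
    proof (intro equalityI subsetI)
      fix \<omega> assume "\<omega> \<in> fst ` G"
      then obtain s where s: "(\<omega>, s) \<in> G" by force
      then obtain z where "s = \<psi> z" using G_sub range by blast
      then show "\<omega> \<in> fst ` ((\<lambda>x. (fst x, \<psi> (snd x))) -` G \<inter> space (M \<Otimes>\<^sub>M borel))"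
        using s G_sub by (intro image_eqI[of _ _ "(\<omega>, z)"]) (auto simp: space_pair_measure)
    qed (force simp: image_iff)
    finally show ?thesis .
  qed
qed

section \<open>Finite covers and the measurability of the intersection\<close>

text \<open>Regularity gives each point a neighbourhood from \<open>\<B>\<close> whose closure
  misses some \<open>C\<close>, and compactness leaves finitely many. Conversely, a point of
  \<open>U\<close> lies outside the \<open>C\<close> that misses the closure of
  \<open>U\<close>.\<close>

lemma compact_disjoint_Inter_iff_finite_cover:
  assumes "compact_space Y" "regular_space Y"
    and \<B>: "\<And>U. U \<in> \<B> \<Longrightarrow> openin Y U"
      "\<And>U x. openin Y U \<Longrightarrow> x \<in> U \<Longrightarrow> \<exists>V\<in>\<B>. x \<in> V \<and> V \<subseteq> U"
    and \<C>: "\<And>C. C \<in> \<C> \<Longrightarrow> closedin Y C"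
  shows "topspace Y \<inter> \<Inter>\<C> = {} \<longleftrightarrow>
    (\<exists>\<U>. finite \<U> \<and> \<U> \<subseteq> \<B> \<and> topspace Y \<subseteq> \<Union>\<U> \<and> (\<forall>U\<in>\<U>. \<exists>C\<in>\<C>. C \<inter> Y closure_of U = {}))"
    (is "?L \<longleftrightarrow> ?R")
proof
  assume ?L
  define \<V> where "\<V> = {U \<in> \<B>. \<exists>C\<in>\<C>. C \<inter> Y closure_of U = {}}"
  have "topspace Y \<subseteq> \<Union>\<V>"
  proof
    fix x assume x: "x \<in> topspace Y"
    then obtain C where C: "C \<in> \<C>" "x \<notin> C" using \<open>?L\<close> by blast
    then obtain U where U: "openin Y U" "x \<in> U" "disjnt C (Y closure_of U)"
      using \<open>regular_space Y\<close> \<C> x unfolding regular_space by blast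
    then obtain V where V: "V \<in> \<B>" "x \<in> V" "V \<subseteq> U" using \<B>(2) by blast
    then have "C \<inter> Y closure_of V = {}"
      using U(3) closure_of_mono[OF V(3), of Y] by (auto simp: disjnt_def)
    then show "x \<in> \<Union>\<V>" using V C by (auto simp: \<V>_def)
  qed
  moreover have "\<And>U. U \<in> \<V> \<Longrightarrow> openin Y U" using \<B>(1) by (auto simp: \<V>_def)
  ultimately obtain \<U> where "finite \<U>" "\<U> \<subseteq> \<V>" "topspace Y \<subseteq> \<Union>\<U>"
    using \<open>compact_space Y\<close> unfolding compact_space_alt by meson
  then show ?R by (intro exI[of _ \<U>]) (auto simp: \<V>_def)
next
  assume ?R
  then obtain \<U> where \<U>: "\<U> \<subseteq> \<B>" "topspace Y \<subseteq> \<Union>\<U>" "\<forall>U\<in>\<U>. \<exists>C\<in>\<C>. C \<inter> Y closure_of U = {}"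
    by blast
  have "x \<notin> \<Inter>\<C>" if x: "x \<in> topspace Y" for x
  proof -
    obtain U where U: "U \<in> \<U>" "x \<in> U" using x \<U>(2) by blast
    then have "x \<in> Y closure_of U" using closure_of_subset \<U>(1) \<B>(1) openin_subset by (metis subsetD)
    then show ?thesis using \<U>(3) U(1) by blast
  qed
  then show ?L by blast
qed

theorem theorem3p4:
  fixes M :: "'w measure" and S :: "'s metric" and X :: "'x topology"
    and F :: "'s \<Rightarrow> 'w \<Rightarrow> 'x set"
  assumes "souslin_space TYPE('p) S"
    and "Hausdorff_space X" and "second_countable_compacts X"
    and "\<And>s. s \<in> mspace S \<Longrightarrow> closed_valued (space M) X (F s)"
    and "compact_measurable_family M S X F"
  shows "universally_compact_measurable M X (family_Inter (mspace S) X F)"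
  unfolding universally_compact_measurable_def
proof (intro allI impI)
  fix K assume K: "compactin X K"
  define Y where "Y = subtopology X K"
  have K_sub: "K \<subseteq> topspace X" using K by (rule compactin_subset_topspace)
  then have top_Y: "topspace Y = K" by (auto simp: Y_def)
  have "compact_space Y" unfolding Y_def using K by (rule compact_space_subtopology)
  moreover have "Hausdorff_space Y" unfolding Y_def using assms(2) by (rule Hausdorff_space_subtopology)
  ultimately have "regular_space Y" by (rule compact_Hausdorff_imp_regular_space)
  obtain \<B> where "countable \<B>" and \<B>: "\<And>U. U \<in> \<B> \<Longrightarrow> openin Y U"
      "\<And>U x. openin Y U \<Longrightarrow> x \<in> U \<Longrightarrow> \<exists>V\<in>\<B>. x \<in> V \<and> V \<subseteq> U"
    using assms(3) K unfolding second_countable_compacts_def second_countable_def Y_def by meson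
  \<comment> \<open>Closures in \<open>Y\<close> are compact, so \<open>N U\<close> is the
    complement of a measurable preimage.\<close>
  define N where "N U = {(\<omega>, s) \<in> space M \<times> mspace S. F s \<omega> \<inter> Y closure_of U = {}}" for U
  have N: "fst ` N U \<in> universally_measurable_sets M" for U
  proof -
    let ?MS = "M \<Otimes>\<^sub>M borel_of (mtopology_of S)"
    have space: "space ?MS = space M \<times> mspace S"
      by (simp add: space_pair_measure)
    have "compactin Y (Y closure_of U)"
      using \<open>compact_space Y\<close> closedin_closure_of by (rule closedin_compact_space)
    then have "compactin X (Y closure_of U)"
      unfolding Y_def by (simp add: compactin_subtopology)
    then have "multi_preimage (space ?MS) (\<lambda>(\<omega>, s). F s \<omega>) (Y closure_of U) \<in> sets ?MS"
      using assms(5) unfolding compact_measurable_family_def compact_measurable_def by blast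
    then have "space ?MS - multi_preimage (space ?MS) (\<lambda>(\<omega>, s). F s \<omega>) (Y closure_of U) \<in> sets ?MS"
      by (rule sets.compl_sets)
    also have "space ?MS - multi_preimage (space ?MS) (\<lambda>(\<omega>, s). F s \<omega>) (Y closure_of U) = N U"
      unfolding space N_def multi_preimage_def by auto
    finally show ?thesis by (rule projection_along_souslin_space_universally_measurable[OF assms(1)])
  qed
  define \<T> where "\<T> = {\<U>. finite \<U> \<and> \<U> \<subseteq> \<B> \<and> K \<subseteq> \<Union>\<U>}"
  have "countable \<T>"
    by (rule countable_subset[OF _ countable_Collect_finite_subset[OF \<open>countable \<B>\<close>]]) (auto simp: \<T>_def)
  have miss_iff: "family_Inter (mspace S) X F \<omega> \<inter> K = {} \<longleftrightarrow> (\<exists>\<U>\<in>\<T>. \<forall>U\<in>\<U>. \<omega> \<in> fst ` N U)"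
    if \<omega>: "\<omega> \<in> space M" for \<omega>
  proof -
    define \<C> where "\<C> = (\<lambda>s. K \<inter> F s \<omega>) ` mspace S"
    have "closedin Y C" if "C \<in> \<C>" for C
      using that assms(4) \<omega> unfolding \<C>_def Y_def closed_valued_def by (auto intro: closedin_subtopology_Int_closed)
    from compact_disjoint_Inter_iff_finite_cover[OF \<open>compact_space Y\<close> \<open>regular_space Y\<close> \<B> this]
    have "K \<inter> \<Inter>\<C> = {} \<longleftrightarrow> (\<exists>\<U>\<in>\<T>. \<forall>U\<in>\<U>. \<exists>C\<in>\<C>. C \<inter> Y closure_of U = {})"
      unfolding top_Y \<T>_def by auto
    \<comment> \<open>For empty \<open>S\<close> both sides are \<open>K\<close>.\<close>
    moreover have "family_Inter (mspace S) X F \<omega> \<inter> K = K \<inter> \<Inter>\<C>"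
      using K_sub by (auto simp: family_Inter_def \<C>_def)
    moreover have "(\<exists>C\<in>\<C>. C \<inter> Y closure_of U = {}) \<longleftrightarrow> \<omega> \<in> fst ` N U" for U
    proof -
      have "K \<inter> F s \<omega> \<inter> Y closure_of U = F s \<omega> \<inter> Y closure_of U" for s
        using closure_of_subset_topspace[of Y U] top_Y by blast
      then show ?thesis using \<omega> by (force simp: \<C>_def N_def image_iff)
    qed
    ultimately show ?thesis by simp
  qed
  \<comment> \<open>The empty cover belongs to \<open>\<T>\<close> when \<open>K\<close> is empty;
    its intersection is \<open>UNIV\<close>, which is cut down to \<open>space M\<close>.\<close>
  have eq: "multi_preimage (space M) (family_Inter (mspace S) X F) K =
      space M - (\<Union>\<U>\<in>\<T>. space M \<inter> (\<Inter>U\<in>\<U>. fst ` N U))"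
  proof (rule set_eqI)
    fix \<omega>
    show "\<omega> \<in> multi_preimage (space M) (family_Inter (mspace S) X F) K \<longleftrightarrow>
        \<omega> \<in> space M - (\<Union>\<U>\<in>\<T>. space M \<inter> (\<Inter>U\<in>\<U>. fst ` N U))"
    proof (cases "\<omega> \<in> space M")
      case True
      then have "\<omega> \<in> multi_preimage (space M) (family_Inter (mspace S) X F) K \<longleftrightarrow>
          \<not> (\<exists>\<U>\<in>\<T>. \<forall>U\<in>\<U>. \<omega> \<in> fst ` N U)"
        unfolding multi_preimage_def miss_iff[OF True, symmetric] by simp
      then show ?thesis using True by (simp only: UN_iff INT_iff Int_iff Diff_iff simp_thms)
    qed (simp add: multi_preimage_def)
  qed
  show "multi_preimage (space M) (family_Inter (mspace S) X F) K \<in> universally_measurable_sets M"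
    unfolding universally_measurable_sets_iff eq
  proof (intro allI impI)
    \<comment> \<open>For a fixed \<nu> only finite intersections, a countable union and a
      complement are formed inside one completed \<sigma>-algebra.\<close>
    fix \<nu> :: "'w measure" assume "finite_measure \<nu>" and \<nu>: "sets \<nu> = sets M"
    then have [measurable]: "fst ` N U \<in> sets (completion \<nu>)" for U
      using N unfolding universally_measurable_sets_iff by blast
    have space: "space M = space (completion \<nu>)" using sets_eq_imp_space_eq[OF \<nu>] by simp
    have "space (completion \<nu>) \<inter> (\<Inter>U\<in>\<U>. fst ` N U) \<in> sets (completion \<nu>)" if "\<U> \<in> \<T>" for \<U>
    proof (cases "\<U> = {}")
      case False
      then have "(\<Inter>U\<in>\<U>. fst ` N U) \<in> sets (completion \<nu>)"
        using that by (intro sets.finite_INT) (auto simp: \<T>_def)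
      then show ?thesis by auto
    qed auto
    then show "space M - (\<Union>\<U>\<in>\<T>. space M \<inter> (\<Inter>U\<in>\<U>. fst ` N U)) \<in> sets (completion \<nu>)"
      unfolding space using \<open>countable \<T>\<close> by (intro sets.compl_sets sets.countable_UN') auto
  qed
qed

end
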